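(* Let $m\in\mathbb N$ and let $C$ be an $m\times\omega$ matrix with rational entries and only finitely many nonzero entries in each row, such that $A=\left(\begin{array}{c}C\\ {\bf D}\end{array}\right)$ is image partition regular, where ${\bf D}$ is the DH-matrix. Then ${\bf D}$ image dominates $A$.
   Context: $\mathbb N=\{1,2,3,\ldots\}$, $\omega=\{0,1,2,\ldots\}$. All matrices have rational entries and only finitely many nonzero entries in each row. A matrix is image partition regular (IPR) if, whenever $\mathbb N$ is finitely coloured, there is a vector $\vec x$ with entries in $\mathbb N$ such that all entries of the image are natural numbers of the same colour. For a vector $\vec x$, $Im(\vec x)$ is the set of its entries. Image domination: for $t,u,v,w\in\mathbb N\cup\{\omega\}$ (or, after relabelling, any countable index sets), a $t\times u$ matrix $A$ image dominates a $v\times w$ matrix $B$ if and only if for each $\vec x\in\mathbb N^u$ there exists $\vec y\in\mathbb N^w$ such that $Im(B\vec y)\subseteq Im(A\vec x)$. The DH-matrix ${\bf D}$: fix an enumeration $\langle B_n\rangle_{n=0}^\infty$ of the finite IPR matrices with rational entries, where $B_n$ is a $u(n)\times v(n)$ matrix. Let $\vec 0_i$ be the zero vector with $i$ entries. ${\bf D}$ is an $\omega\times\omega$ matrix whose rows are all the concatenations $\vec r_0{}^\frown\vec r_1{}^\frown\vec r_2{}^\frown\cdots$ where each $\vec r_i$ is either $\vec 0_{v(i)}$ or a row of $B_i$, and all but finitely many (but not all) of the $\vec r_i$ are $\vec 0_{v(i)}$. *)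

theory Defs
  imports Complex_Main "Jordan_Normal_Form.Matrix"
begin

text \<open>
  A possibly infinite rational matrix is a function \<open>A :: 'i \<Rightarrow> 'j \<Rightarrow> rat\<close> together with
  a set \<open>I\<close> of row indices and a set \<open>J\<close> of column indices; an \<open>m \<times> \<omega>\<close> matrix has
  \<open>I = {..<m}\<close> and \<open>J = UNIV :: nat set\<close>. The natural numbers of the source start at 1,
  so positivity is always stated explicitly.
\<close>

definition row_finite :: "'i set \<Rightarrow> 'j set \<Rightarrow> ('i \<Rightarrow> 'j \<Rightarrow> rat) \<Rightarrow> bool" where
  "row_finite I J A \<longleftrightarrow> (\<forall>i\<in>I. finite {j\<in>J. A i j \<noteq> 0})"

definition pos_vecs :: "'j set \<Rightarrow> ('j \<Rightarrow> nat) set" where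
  "pos_vecs J = {x. \<forall>j\<in>J. 1 \<le> x j}"

text \<open>The set of entries of the product of \<open>A\<close> and \<open>x\<close>. The sum runs over the support of the
  row, which is finite for the matrices considered here.\<close>

definition mat_image :: "'i set \<Rightarrow> 'j set \<Rightarrow> ('i \<Rightarrow> 'j \<Rightarrow> rat) \<Rightarrow> ('j \<Rightarrow> nat) \<Rightarrow> rat set" where
  "mat_image I J A x = (\<lambda>i. \<Sum>j\<in>{j\<in>J. A i j \<noteq> 0}. A i j * of_nat (x j)) ` I"

definition image_partition_regular :: "'i set \<Rightarrow> 'j set \<Rightarrow> ('i \<Rightarrow> 'j \<Rightarrow> rat) \<Rightarrow> bool" where
  "image_partition_regular I J A \<longleftrightarrow>
     (\<forall>\<chi> :: nat \<Rightarrow> nat. finite (\<chi> ` {1..}) \<longrightarrow>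
        (\<exists>x\<in>pos_vecs J. \<exists>k. mat_image I J A x \<subseteq> of_nat ` {n. 1 \<le> n \<and> \<chi> n = k}))"

definition image_dominates ::
    "'i set \<Rightarrow> 'j set \<Rightarrow> ('i \<Rightarrow> 'j \<Rightarrow> rat) \<Rightarrow> 'k set \<Rightarrow> 'l set \<Rightarrow> ('k \<Rightarrow> 'l \<Rightarrow> rat) \<Rightarrow> bool" where
  "image_dominates I J A K L B \<longleftrightarrow>
     (\<forall>x\<in>pos_vecs J. \<exists>y\<in>pos_vecs L. mat_image K L B y \<subseteq> mat_image I J A x)"

definition finite_ipr_matrices :: "rat mat set" where
  "finite_ipr_matrices =
     {M. 1 \<le> dim_row M \<and> 1 \<le> dim_col M \<and>
         image_partition_regular {..<dim_row M} {..<dim_col M} (\<lambda>i j. M $$ (i, j))}"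

text \<open>The column of the concatenation at which the block of \<open>B n\<close> begins.\<close>

definition block_start :: "(nat \<Rightarrow> rat mat) \<Rightarrow> nat \<Rightarrow> nat" where
  "block_start B n = (\<Sum>i<n. dim_col (B i))"

text \<open>\<open>s\<close> is the concatenation of the blocks \<open>r 0, r 1, \<dots>\<close>. As every \<open>B n\<close> has at least one
  column, the blocks cover all of the natural numbers, so \<open>r\<close> determines \<open>s\<close>.\<close>

definition DH_rows :: "(nat \<Rightarrow> rat mat) \<Rightarrow> (nat \<Rightarrow> rat) set" where
  "DH_rows B =
     {s. \<exists>r :: nat \<Rightarrow> rat vec.
           (\<forall>n. r n = 0\<^sub>v (dim_col (B n)) \<or> r n \<in> set (rows (B n))) \<and>
           finite {n. r n \<noteq> 0\<^sub>v (dim_col (B n))} \<and>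
           (\<exists>n. r n \<noteq> 0\<^sub>v (dim_col (B n))) \<and>
           (\<forall>n. \<forall>l<dim_col (B n). s (block_start B n + l) = r n $ l)}"

text \<open>\<open>D\<close> is a DH-matrix for the enumeration \<open>B\<close> of the finite image partition regular
  matrices. Neither the enumeration \<open>B\<close> nor the listing of the rows of \<open>D\<close> is prescribed, and
  either may have repetitions.\<close>

definition DH_matrix :: "(nat \<Rightarrow> rat mat) \<Rightarrow> (nat \<Rightarrow> nat \<Rightarrow> rat) \<Rightarrow> bool" where
  "DH_matrix B D \<longleftrightarrow> range B = finite_ipr_matrices \<and> range D = DH_rows B"

text \<open>The first \<open>m\<close> rows of \<open>C\<close> followed by the rows of \<open>D\<close>.\<close>

definition stack :: "nat \<Rightarrow> (nat \<Rightarrow> 'j \<Rightarrow> rat) \<Rightarrow> (nat \<Rightarrow> 'j \<Rightarrow> rat) \<Rightarrow> nat \<Rightarrow> 'j \<Rightarrow> rat" where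
  "stack m C D i = (if i < m then C i else D (i - m))"

end

theory Submission
  imports Defs "HOL-Library.Infinite_Set"
begin

text \<open>
  The matrix \<open>C\<close> only involves the columns of the first \<open>N\<close> blocks of \<open>D\<close>, for some \<open>N\<close>. The rows
  of \<open>C\<close> and the rows of \<open>D\<close> supported on these blocks form a finite matrix \<open>M\<close>, which inherits
  image partition regularity. Repeating a row does not change the image of a matrix, so every
  finite image partition regular matrix has infinitely many copies with the same images among the
  \<open>B n\<close>. Given \<open>x\<close>, choose \<open>y\<close> on the first \<open>N\<close> blocks as \<open>x\<close> on the block of a copy of \<open>M\<close>, and
  on each block \<open>n \<ge> N\<close> as \<open>x\<close> on the block of a copy of \<open>B n\<close>, all these copies being different. A
  sum over the blocks of \<open>y\<close> is then a sum over different blocks of \<open>x\<close>.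
\<close>

section \<open>Values of rows and images of finite matrices\<close>

definition row_value :: "('j \<Rightarrow> rat) \<Rightarrow> ('j \<Rightarrow> nat) \<Rightarrow> rat" where
  "row_value s x = (\<Sum>j | s j \<noteq> 0. s j * of_nat (x j))"

definition fin_image :: "rat mat \<Rightarrow> (nat \<Rightarrow> nat) \<Rightarrow> rat set" where
  "fin_image M x = mat_image {..<dim_row M} {..<dim_col M} (\<lambda>i j. M $$ (i, j)) x"

text \<open>\<open>DH_matrix\<close> fixes only the set of rows of \<open>D\<close>, not their
  listing. Taking the row itself as the argument of \<open>row_value\<close> makes that set
  sufficient.\<close>

lemma mat_image_UNIV: "mat_image UNIV UNIV A x = (\<lambda>s. row_value s x) ` range A"
  by (simp add: mat_image_def row_value_def image_image)

lemma row_value_eq_sum: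
  fixes s :: "nat \<Rightarrow> rat"
  assumes "\<And>j. K \<le> j \<Longrightarrow> s j = 0"
  shows "row_value s x = (\<Sum>j<K. s j * of_nat (x j))"
  unfolding row_value_def
  by (rule sum.mono_neutral_left) (use assms in \<open>auto simp: not_less[symmetric]\<close>)

text \<open>The matrix enters only through its width and its set of rows, so repetitions and order
  of rows do not matter.\<close>

lemma fin_image_eq:
  "fin_image M x = (\<lambda>v. \<Sum>l<dim_col M. v $ l * of_nat (x l)) ` set (rows M)"
proof -
  have "(\<Sum>j\<in>{j \<in> {..<dim_col M}. M $$ (i, j) \<noteq> 0}. M $$ (i, j) * of_nat (x j))
      = (\<Sum>l<dim_col M. row M i $ l * of_nat (x l))" if "i < dim_row M" for i
  proof -
    have "(\<Sum>j\<in>{j \<in> {..<dim_col M}. M $$ (i, j) \<noteq> 0}. M $$ (i, j) * of_nat (x j))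
      = (\<Sum>l<dim_col M. M $$ (i, l) * of_nat (x l))"
      by (rule sum.mono_neutral_left) auto
    also have "\<dots> = (\<Sum>l<dim_col M. row M i $ l * of_nat (x l))"
      using that by (intro sum.cong) auto
    finally show ?thesis .
  qed
  then show ?thesis
    unfolding fin_image_def mat_image_def rows_def
    by (auto simp: image_image intro!: image_cong)
qed

lemma fin_image_cong:
  assumes "\<And>l. l < dim_col M \<Longrightarrow> x l = y l"
  shows "fin_image M x = fin_image M y"
  unfolding fin_image_eq using assms by (intro image_cong sum.cong refl) auto

lemma finite_ipr_matrices_iff:
  "M \<in> finite_ipr_matrices \<longleftrightarrow> 1 \<le> dim_row M \<and> 1 \<le> dim_col M \<and>
     (\<forall>\<chi> :: nat \<Rightarrow> nat. finite (\<chi> ` {1..}) \<longrightarrow>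
        (\<exists>x\<in>pos_vecs {..<dim_col M}. \<exists>k. fin_image M x \<subseteq> of_nat ` {n. 1 \<le> n \<and> \<chi> n = k}))"
  unfolding finite_ipr_matrices_def image_partition_regular_def fin_image_def by simp

text \<open>A zero row would put 0 into every image, while regularity for the constant colouring
  already gives an image of positive numbers. Hence choosing a row in a block is always distinct
  from leaving the block zero.\<close>

lemma rows_ipr_nonzero:
  assumes "M \<in> finite_ipr_matrices" "v \<in> set (rows M)"
  shows "v \<noteq> 0\<^sub>v (dim_col M)"
proof
  assume v: "v = 0\<^sub>v (dim_col M)"
  have "finite ((\<lambda>_. 0 :: nat) ` {1 :: nat..})"
    by (rule finite_subset[of _ "{0}"]) auto
  then obtain x k where "fin_image M x \<subseteq> of_nat ` {n. 1 \<le> n \<and> (\<lambda>_. 0 :: nat) n = k}"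
    using assms(1) unfolding finite_ipr_matrices_iff by (meson)
  moreover have "0 \<in> fin_image M x"
    unfolding fin_image_eq using assms(2) v by (auto intro!: image_eqI[of _ _ v])
  ultimately show False by auto
qed

section \<open>Repetition of a row\<close>

definition repeat_row :: "rat mat \<Rightarrow> nat \<Rightarrow> rat mat" where
  "repeat_row M t = mat (dim_row M + t) (dim_col M) (\<lambda>(i, j). M $$ (if i < dim_row M then i else 0, j))"

lemma dim_repeat_row [simp]:
  "dim_row (repeat_row M t) = dim_row M + t" "dim_col (repeat_row M t) = dim_col M"
  by (auto simp: repeat_row_def)

lemma set_rows_repeat_row:
  assumes "1 \<le> dim_row M"
  shows "set (rows (repeat_row M t)) = set (rows M)"
proof -
  have r: "row (repeat_row M t) i = row M (if i < dim_row M then i else 0)" if "i < dim_row M + t" for i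
    using that assms by (intro eq_vecI) (auto simp: repeat_row_def)
  show ?thesis
  proof
    show "set (rows (repeat_row M t)) \<subseteq> set (rows M)"
      using r assms by (auto simp: rows_def)
    show "set (rows M) \<subseteq> set (rows (repeat_row M t))"
    proof
      fix v assume "v \<in> set (rows M)"
      then obtain i where "i < dim_row M" "v = row M i" by (auto simp: rows_def)
      with r[of i] show "v \<in> set (rows (repeat_row M t))"
        by (auto simp: rows_def intro!: image_eqI[of _ _ i])
    qed
  qed
qed

lemma fin_image_repeat_row:
  "1 \<le> dim_row M \<Longrightarrow> fin_image (repeat_row M t) = fin_image M"
  by (simp add: fun_eq_iff fin_image_eq set_rows_repeat_row)

section \<open>The enumerated matrices and their blocks of columns\<close>

locale ipr_enumeration =
  fixes B :: "nat \<Rightarrow> rat mat"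
  assumes range_B: "range B = finite_ipr_matrices"
begin

lemma B_ipr: "B n \<in> finite_ipr_matrices"
  using range_B by auto

lemma dim_col_pos: "1 \<le> dim_col (B n)"
  using B_ipr[of n] by (simp add: finite_ipr_matrices_iff)

text \<open>The matrices \<open>repeat_row M t\<close> differ in their number of rows, so they are
  infinitely many, and all have the image of \<open>M\<close>. Each is some \<open>B k\<close>, and
  one index \<open>k\<close> accounts for only one of them.\<close>

lemma infinite_copies:
  assumes M: "M \<in> finite_ipr_matrices"
  shows "infinite {k. dim_col (B k) = dim_col M \<and> fin_image (B k) = fin_image M}" (is "infinite ?S")
proof
  assume "finite ?S"
  have m1: "1 \<le> dim_row M" using M by (simp add: finite_ipr_matrices_iff)
  have "range (repeat_row M) \<subseteq> B ` ?S"
  proof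
    fix M' assume "M' \<in> range (repeat_row M)"
    then obtain t where t: "M' = repeat_row M t" by auto
    then have "M' \<in> finite_ipr_matrices"
      using M m1 by (simp add: finite_ipr_matrices_iff fin_image_repeat_row)
    then obtain k where "M' = B k" using range_B by blast
    with t m1 show "M' \<in> B ` ?S" by (auto simp: fin_image_repeat_row intro!: image_eqI[of _ _ k])
  qed
  then have "finite (range (repeat_row M))"
    using \<open>finite ?S\<close> by (meson finite_imageI finite_subset)
  moreover have "inj (repeat_row M)"
    by (rule injI) (metis add_left_cancel dim_repeat_row(1))
  ultimately show False using finite_imageD by blast
qed

lemma block_start_Suc: "block_start B (Suc n) = block_start B n + dim_col (B n)"
  by (simp add: block_start_def)

lemma le_block_start: "n \<le> block_start B n"
proof (induction n)
  case (Suc n)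
  then show ?case using dim_col_pos[of n] by (simp add: block_start_Suc)
qed simp

lemma block_start_mono: "i \<le> n \<Longrightarrow> block_start B i \<le> block_start B n"
  unfolding block_start_def by (rule sum_mono2) auto

definition block_of :: "nat \<Rightarrow> nat" where
  "block_of j = (LEAST n. j < block_start B (Suc n))"

lemma block_of_eq:
  assumes "l < dim_col (B n)"
  shows "block_of (block_start B n + l) = n"
  unfolding block_of_def
proof (rule Least_equality)
  show "block_start B n + l < block_start B (Suc n)" using assms by (simp add: block_start_Suc)
  fix i assume "block_start B n + l < block_start B (Suc i)"
  then show "n \<le> i" using block_start_mono[of "Suc i" n] by (cases "n \<le> i") auto
qed

text \<open>Every block has a column, so the block starts are unbounded. The block of
  \<open>j\<close> is the first one that ends beyond \<open>j\<close>.\<close>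

lemma block_cover: "\<exists>n. \<exists>l<dim_col (B n). j = block_start B n + l"
proof -
  define n where "n = (LEAST n. j < block_start B (Suc n))"
  have "j < block_start B (Suc j)" using le_block_start[of "Suc j"] by simp
  then have 1: "j < block_start B (Suc n)" unfolding n_def by (rule LeastI)
  have "block_start B n \<le> j"
  proof (cases n)
    case 0
    then show ?thesis by (simp add: block_start_def)
  next
    case (Suc i)
    then show ?thesis
      using not_less_Least[of i "\<lambda>n. j < block_start B (Suc n)"] by (simp add: n_def)
  qed
  with 1 show ?thesis
    by (intro exI[of _ n] exI[of _ "j - block_start B n"]) (auto simp: block_start_Suc)
qed

lemma block_less:
  assumes "block_start B n + l < block_start B N"
  shows "n < N"
  using assms block_start_mono[of N n] by (cases "n < N") auto

lemma sum_blocks: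
  "(\<Sum>j<block_start B N. f j) = (\<Sum>n<N. \<Sum>l<dim_col (B n). f (block_start B n + l))"
  for f :: "nat \<Rightarrow> rat"
proof (induction N)
  case 0
  then show ?case by (simp add: block_start_def)
next
  case (Suc N)
  have "(\<Sum>j<a + b. f j) = (\<Sum>j<a. f j) + (\<Sum>l<b. f (a + l))" for a b :: nat
    by (induction b) (auto simp: add.assoc)
  then have "(\<Sum>j<block_start B (Suc N). f j)
      = (\<Sum>j<block_start B N. f j) + (\<Sum>l<dim_col (B N). f (block_start B N + l))"
    by (simp add: block_start_Suc)
  with Suc show ?case by simp
qed

section \<open>Rows of the DH-matrix as sums over blocks\<close>

abbreviation block_vec :: "(nat \<Rightarrow> nat) \<Rightarrow> nat \<Rightarrow> nat \<Rightarrow> nat" where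
  "block_vec y n \<equiv> \<lambda>l. y (block_start B n + l)"

lemma row_value_blocks:
  assumes s: "\<And>n l. l < dim_col (B n) \<Longrightarrow> s (block_start B n + l) = r n $ l"
    and F: "finite F" "\<And>n. n \<notin> F \<Longrightarrow> r n = 0\<^sub>v (dim_col (B n))"
  shows "row_value s y = (\<Sum>n\<in>F. \<Sum>l<dim_col (B n). r n $ l * of_nat (block_vec y n l))"
proof -
  obtain N where N: "F \<subseteq> {..<N}" using F(1) finite_nat_bounded by blast
  have z: "s j = 0" if "block_start B N \<le> j" for j
  proof -
    obtain n l where nl: "l < dim_col (B n)" "j = block_start B n + l" using block_cover by blast
    have "N \<le> n"
      using that nl block_start_mono[of "Suc n" N] by (cases "N \<le> n") (auto simp: block_start_Suc)
    with N have "n \<notin> F" by auto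
    with F(2) s nl show ?thesis by simp
  qed
  have "row_value s y = (\<Sum>j<block_start B N. s j * of_nat (y j))"
    by (rule row_value_eq_sum) (rule z)
  also have "\<dots> = (\<Sum>n<N. \<Sum>l<dim_col (B n). r n $ l * of_nat (block_vec y n l))"
    unfolding sum_blocks by (intro sum.cong refl) (simp add: s)
  also have "\<dots> = (\<Sum>n\<in>F. \<Sum>l<dim_col (B n). r n $ l * of_nat (block_vec y n l))"
    by (rule sum.mono_neutral_right) (use N F(2) in auto)
  finally show ?thesis .
qed

text \<open>\<open>F\<close> is the set of nonzero blocks of the row. Each of them is a row of
  \<open>B n\<close> and contributes an entry of the image of \<open>B n\<close>.\<close>

lemma DH_row_value_decomp:
  assumes "s \<in> DH_rows B"
  obtains F f where "finite F" "F \<noteq> {}" "\<And>n. n \<in> F \<Longrightarrow> f n \<in> fin_image (B n) (block_vec y n)"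
    "row_value s y = sum f F"
proof -
  obtain r where r: "\<And>n. r n = 0\<^sub>v (dim_col (B n)) \<or> r n \<in> set (rows (B n))"
    "finite {n. r n \<noteq> 0\<^sub>v (dim_col (B n))}" "\<exists>n. r n \<noteq> 0\<^sub>v (dim_col (B n))"
    "\<And>n l. l < dim_col (B n) \<Longrightarrow> s (block_start B n + l) = r n $ l"
    using assms unfolding DH_rows_def by blast
  show ?thesis
  proof (rule that)
    show "row_value s y = (\<Sum>n | r n \<noteq> 0\<^sub>v (dim_col (B n)).
        \<Sum>l<dim_col (B n). r n $ l * of_nat (block_vec y n l))"
      by (rule row_value_blocks) (use r in auto)
  qed (use r in \<open>auto simp: fin_image_eq\<close>)
qed

text \<open>Converse of the decomposition: concatenate rows that realise the summands. The last
  conclusion serves to recognise rows confined to the first blocks.\<close>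

lemma DH_row_value_compose:
  assumes F: "finite F" "F \<noteq> {}" and f: "\<And>n. n \<in> F \<Longrightarrow> f n \<in> fin_image (B n) (block_vec y n)"
  obtains s where "s \<in> DH_rows B" "row_value s y = sum f F"
    "\<And>n l. n \<notin> F \<Longrightarrow> l < dim_col (B n) \<Longrightarrow> s (block_start B n + l) = 0"
proof -
  have "\<forall>n\<in>F. \<exists>v\<in>set (rows (B n)). f n = (\<Sum>l<dim_col (B n). v $ l * of_nat (block_vec y n l))"
    using f unfolding fin_image_eq by blast
  then obtain v where v: "\<And>n. n \<in> F \<Longrightarrow> v n \<in> set (rows (B n))"
    "\<And>n. n \<in> F \<Longrightarrow> f n = (\<Sum>l<dim_col (B n). v n $ l * of_nat (block_vec y n l))"
    by metis
  define r where "r n = (if n \<in> F then v n else 0\<^sub>v (dim_col (B n)))" for n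
  define s where "s j = r (block_of j) $ (j - block_start B (block_of j))" for j
  have s: "s (block_start B n + l) = r n $ l" if "l < dim_col (B n)" for n l
    using that by (simp add: s_def block_of_eq)
  \<comment> \<open>As no row of \<open>B n\<close> is zero, the nonzero blocks of \<open>r\<close>
    are exactly those in \<open>F\<close>: finitely many, and at least one.\<close>
  have nz: "r n \<noteq> 0\<^sub>v (dim_col (B n)) \<longleftrightarrow> n \<in> F" for n
    using v(1)[of n] rows_ipr_nonzero[OF B_ipr[of n]] by (auto simp: r_def)
  show ?thesis
  proof (rule that)
    have "(\<forall>n. r n = 0\<^sub>v (dim_col (B n)) \<or> r n \<in> set (rows (B n))) \<and>
           finite {n. r n \<noteq> 0\<^sub>v (dim_col (B n))} \<and>
           (\<exists>n. r n \<noteq> 0\<^sub>v (dim_col (B n))) \<and>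
           (\<forall>n. \<forall>l<dim_col (B n). s (block_start B n + l) = r n $ l)"
      unfolding nz using F s v(1) by (auto simp: r_def)
    then show "s \<in> DH_rows B" unfolding DH_rows_def by blast
    have "row_value s y = (\<Sum>n\<in>F. \<Sum>l<dim_col (B n). r n $ l * of_nat (block_vec y n l))"
      by (rule row_value_blocks) (use s F in \<open>auto simp: r_def\<close>)
    also have "\<dots> = sum f F" by (intro sum.cong refl) (simp add: v(2) r_def)
    finally show "row_value s y = sum f F" .
    show "s (block_start B n + l) = 0" if "n \<notin> F" "l < dim_col (B n)" for n l
      using s that by (simp add: r_def)
  qed
qed

section \<open>Rows supported on the first blocks\<close>

definition truncated_rows :: "nat \<Rightarrow> rat vec set" where
  "truncated_rows N = {vec (block_start B N) s | s. s \<in> DH_rows B \<and> (\<forall>j\<ge>block_start B N. s j = 0)}"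

text \<open>The vectors have a fixed length, and each coordinate is 0 or an entry of one of the
  finitely many matrices \<open>B n\<close> with \<open>n < N\<close>.\<close>

lemma finite_truncated_rows: "finite (truncated_rows N)"
proof -
  define K where "K = block_start B N"
  define E where "E = insert 0 (\<Union>n<N. \<Union>v\<in>set (rows (B n)). (\<lambda>l. v $ l) ` {..<dim_col (B n)})"
  have E: "finite E" unfolding E_def by auto
  have "truncated_rows N \<subseteq> vec_of_list ` {xs. set xs \<subseteq> E \<and> length xs = K}"
  proof
    fix v assume "v \<in> truncated_rows N"
    then obtain s where s: "v = vec K s" "s \<in> DH_rows B"
      by (auto simp: truncated_rows_def K_def)
    then obtain r where r: "\<And>n. r n = 0\<^sub>v (dim_col (B n)) \<or> r n \<in> set (rows (B n))"
      "\<And>n l. l < dim_col (B n) \<Longrightarrow> s (block_start B n + l) = r n $ l"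
      unfolding DH_rows_def by blast
    have "s j \<in> E" if "j < K" for j
    proof -
      obtain n l where nl: "l < dim_col (B n)" "j = block_start B n + l" using block_cover by blast
      then have "n < N" using that block_less unfolding K_def by blast
      then show ?thesis using nl r(1)[of n] r(2)[of l n] unfolding E_def by auto
    qed
    moreover have "v = vec_of_list (map s [0..<K])"
      unfolding s(1) by (intro eq_vecI) (auto simp: vec_of_list_index)
    ultimately show "v \<in> vec_of_list ` {xs. set xs \<subseteq> E \<and> length xs = K}"
      by (auto intro!: image_eqI[of _ _ "map s [0..<K]"])
  qed
  moreover have "finite {xs. set xs \<subseteq> E \<and> length xs = K}"
    using E by (rule finite_lists_length_eq)
  ultimately show ?thesis by (meson finite_imageI finite_subset)
qed

text \<open>Each matrix has infinitely many copies, so the indices can be chosen strictly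
  increasing. This keeps them distinct even where \<open>P\<close> repeats a matrix.\<close>

lemma exists_choice_of_copies:
  fixes P :: "nat \<Rightarrow> rat mat"
  assumes "\<And>n. P n \<in> finite_ipr_matrices"
  obtains k where "inj k" "\<And>n. dim_col (B (k n)) = dim_col (P n)"
    "\<And>n. fin_image (B (k n)) = fin_image (P n)"
proof -
  define S where "S n = {k. dim_col (B k) = dim_col (P n) \<and> fin_image (B k) = fin_image (P n)}" for n
  have S: "infinite (S n)" for n unfolding S_def using assms by (rule infinite_copies)
  have "\<exists>k. \<forall>n. k n \<in> S n \<and> k n < k (Suc n)"
  proof (rule dependent_nat_choice)
    show "\<exists>i. i \<in> S 0" using S[of 0] by (metis finite.emptyI ex_in_conv)
    show "\<exists>j. j \<in> S (Suc n) \<and> i < j" for i n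
      using S[of "Suc n"] infinite_nat_iff_unbounded by blast
  qed
  then obtain k where k: "\<And>n. k n \<in> S n" "\<And>n. k n < k (Suc n)" by blast
  show ?thesis
  proof (rule that)
    show "inj k" using k(2) by (simp add: strict_mono_Suc_iff strict_mono_imp_inj_on)
  qed (use k(1) in \<open>auto simp: S_def\<close>)
qed

end

section \<open>Domination by the DH-matrix\<close>

theorem theorem5p1:
  fixes m :: nat and C D :: "nat \<Rightarrow> nat \<Rightarrow> rat" and B :: "nat \<Rightarrow> rat mat"
  assumes "1 \<le> m"
    and "row_finite {..<m} UNIV C"
    and "DH_matrix B D"
    and "image_partition_regular UNIV UNIV (stack m C D)"
  shows "image_dominates UNIV UNIV D UNIV UNIV (stack m C D)"
proof -
  interpret ipr_enumeration B
    using assms(3) by unfold_locales (simp add: DH_matrix_def)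
  have range_D: "range D = DH_rows B" using assms(3) by (simp add: DH_matrix_def)
  have range_stack: "range (stack m C D) = C ` {..<m} \<union> DH_rows B"
  proof -
    have "D i = stack m C D (m + i)" for i by (simp add: stack_def)
    then have "range D \<subseteq> range (stack m C D)" by auto
    moreover have "C ` {..<m} \<subseteq> range (stack m C D)"
      by (auto simp: stack_def intro!: image_eqI)
    moreover have "range (stack m C D) \<subseteq> C ` {..<m} \<union> range D" by (auto simp: stack_def)
    ultimately show ?thesis unfolding range_D by blast
  qed

  have "finite (\<Union>i<m. {j. C i j \<noteq> 0})" using assms(2) by (auto simp: row_finite_def)
  then obtain N0 where N0: "(\<Union>i<m. {j. C i j \<noteq> 0}) \<subseteq> {..<N0}" using finite_nat_bounded by blast
  \<comment> \<open>The rows of \<open>C\<close> vanish from \<open>N0\<close> on, hence from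
    \<open>K\<close> on. The successor makes \<open>N\<close> positive, so that \<open>M\<close> has
    a column and index 0 differs from every block index \<open>n\<close> with
    \<open>N \<le> n\<close>.\<close>
  define N where "N = Suc N0"
  define K where "K = block_start B N"
  have NK: "N \<le> K" unfolding K_def by (rule le_block_start)
  have CK: "C i j = 0" if "i < m" "K \<le> j" for i j
    using that NK N0 unfolding N_def by fastforce

  obtain L where L: "set L = truncated_rows N" using finite_truncated_rows finite_list by blast
  define M where "M = mat_of_rows K (map (\<lambda>i. vec K (C i)) [0..<m] @ L)"
  have "dim_row M \<ge> 1" "dim_col M = K" unfolding M_def using assms(1) by auto
  have "set (map (\<lambda>i. vec K (C i)) [0..<m] @ L) \<subseteq> carrier_vec K"
    using L by (auto simp: truncated_rows_def K_def)
  then have rows_M: "set (rows M) = (\<lambda>i. vec K (C i)) ` {..<m} \<union> truncated_rows N"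
    unfolding M_def using L by (subst rows_mat_of_rows) auto
  \<comment> \<open>Cutting at \<open>K\<close> loses nothing: the rows of \<open>C\<close> and the
    chosen rows of \<open>D\<close> all vanish from \<open>K\<close> on.\<close>
  have M_image: "fin_image M y = (\<lambda>s. row_value s y) `
      (C ` {..<m} \<union> {s \<in> DH_rows B. \<forall>j\<ge>K. s j = 0})" for y
  proof -
    have "set (rows M) = vec K ` (C ` {..<m} \<union> {s \<in> DH_rows B. \<forall>j\<ge>K. s j = 0})"
      unfolding rows_M truncated_rows_def K_def by auto
    then have "fin_image M y = (\<lambda>s. \<Sum>l<K. vec K s $ l * of_nat (y l)) `
        (C ` {..<m} \<union> {s \<in> DH_rows B. \<forall>j\<ge>K. s j = 0})"
      by (simp add: fin_image_eq \<open>dim_col M = K\<close> image_image)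
    also have "\<dots> = (\<lambda>s. row_value s y) ` (C ` {..<m} \<union> {s \<in> DH_rows B. \<forall>j\<ge>K. s j = 0})"
    proof (rule image_cong[OF refl])
      fix s assume "s \<in> C ` {..<m} \<union> {s \<in> DH_rows B. \<forall>j\<ge>K. s j = 0}"
      then have "\<And>j. K \<le> j \<Longrightarrow> s j = 0" using CK by auto
      then have "row_value s y = (\<Sum>l<K. s l * of_nat (y l))" by (rule row_value_eq_sum)
      then show "(\<Sum>l<K. vec K s $ l * of_nat (y l)) = row_value s y" by simp
    qed
    finally show ?thesis .
  qed
  have M_sub: "fin_image M y \<subseteq> mat_image UNIV UNIV (stack m C D) y" for y
    unfolding M_image mat_image_UNIV range_stack by auto
  \<comment> \<open>A vector that works for the stacked matrix also works for \<open>M\<close>,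
    whose image is a subset.\<close>
  have M_ipr: "M \<in> finite_ipr_matrices"
    unfolding finite_ipr_matrices_iff
  proof (intro conjI allI impI)
    show "1 \<le> dim_row M" by fact
    show "1 \<le> dim_col M" using NK \<open>dim_col M = K\<close> by (simp add: N_def)
    fix \<chi> :: "nat \<Rightarrow> nat" assume "finite (\<chi> ` {1..})"
    then obtain x k where "x \<in> pos_vecs UNIV"
      "mat_image UNIV UNIV (stack m C D) x \<subseteq> of_nat ` {n. 1 \<le> n \<and> \<chi> n = k}"
      using assms(4) unfolding image_partition_regular_def by meson
    then show "\<exists>x\<in>pos_vecs {..<dim_col M}. \<exists>k. fin_image M x \<subseteq> of_nat ` {n. 1 \<le> n \<and> \<chi> n = k}"
      using M_sub[of x] by (intro bexI[of _ x] exI[of _ k]) (auto simp: pos_vecs_def)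
  qed

  \<comment> \<open>Block \<open>k 0\<close> will stand for the first \<open>N\<close> blocks
    together, and block \<open>k n\<close> for block \<open>n\<close> when
    \<open>N \<le> n\<close>.\<close>
  obtain k where k: "inj k" "\<And>n. dim_col (B (k n)) = dim_col (if n < N then M else B n)"
    "\<And>n. fin_image (B (k n)) = fin_image (if n < N then M else B n)"
    by (rule exists_choice_of_copies[of "\<lambda>n. if n < N then M else B n"]) (use M_ipr B_ipr in auto)

  show ?thesis
    unfolding image_dominates_def
  proof
    fix x :: "nat \<Rightarrow> nat" assume x: "x \<in> pos_vecs UNIV"
    \<comment> \<open>The first \<open>N\<close> blocks have total width \<open>K\<close>, which is
      the width of block \<open>k 0\<close>, so \<open>x\<close> on that block fills them all at
      once. A column of a later block keeps its position inside the block.\<close>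
    define y where "y j = (if j < K then block_vec x (k 0) j
      else block_vec x (k (block_of j)) (j - block_start B (block_of j)))" for j
    have y_pos: "y \<in> pos_vecs UNIV" using x by (auto simp: y_def pos_vecs_def)
    have y_M: "fin_image M y = fin_image (B (k 0)) (block_vec x (k 0))"
      unfolding k(3) using fin_image_cong[of M y "block_vec x (k 0)"]
      by (simp add: y_def N_def \<open>dim_col M = K\<close>)
    have y_B: "fin_image (B n) (block_vec y n) = fin_image (B (k n)) (block_vec x (k n))"
      if "N \<le> n" for n
    proof -
      have "\<not> block_start B n + l < K" for l using that block_less unfolding K_def by force
      then have "fin_image (B n) (block_vec y n) = fin_image (B n) (block_vec x (k n))"
        by (intro fin_image_cong) (simp add: y_def block_of_eq)
      then show ?thesis using that by (simp add: k(3))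
    qed
    \<comment> \<open>Injectivity of \<open>k\<close> places the summands in different blocks of
      \<open>x\<close>. Rows realising them concatenate to a row of \<open>D\<close>, after
      reindexing by the inverse of \<open>k\<close>.\<close>
    have sums: "sum f F \<in> mat_image UNIV UNIV D x"
      if F: "finite F" "F \<noteq> {}" and f: "\<And>n. n \<in> F \<Longrightarrow> f n \<in> fin_image (B (k n)) (block_vec x (k n))"
      for F f
    proof -
      have inv: "inv_into UNIV k (k n) = n" for n using k(1) by simp
      have "\<And>n. n \<in> k ` F \<Longrightarrow> f (inv_into UNIV k n) \<in> fin_image (B n) (block_vec x n)"
        using f inv by auto
      then obtain s where "s \<in> DH_rows B" "row_value s x = sum (\<lambda>n. f (inv_into UNIV k n)) (k ` F)"
        using DH_row_value_compose[of "k ` F" "\<lambda>n. f (inv_into UNIV k n)" x] F by (metis finite_imageI image_is_empty)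
      moreover have "sum (\<lambda>n. f (inv_into UNIV k n)) (k ` F) = sum f F"
        using k(1) by (subst sum.reindex) (auto simp: inv intro: inj_on_subset)
      ultimately show ?thesis unfolding mat_image_UNIV range_D by (metis imageI)
    qed
    \<comment> \<open>An entry of the image of \<open>M\<close> at \<open>y\<close> is a sum with
      the single summand coming from block \<open>k 0\<close>.\<close>
    have M_in: "fin_image M y \<subseteq> mat_image UNIV UNIV D x"
      using sums[of "{0}"] by (auto simp: y_M)
    have "row_value s y \<in> mat_image UNIV UNIV D x" if s: "s \<in> DH_rows B" for s
    proof -
      obtain F f where F: "finite F" "F \<noteq> {}" and
        f: "\<And>n. n \<in> F \<Longrightarrow> f n \<in> fin_image (B n) (block_vec y n)" and
        sF: "row_value s y = sum f F"
        using DH_row_value_decomp[OF s] by metis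
      \<comment> \<open>Blocks below \<open>N\<close> must be treated jointly, since
        \<open>y\<close> takes all of them from the one block \<open>k 0\<close> of
        \<open>x\<close>.\<close>
      define F1 where "F1 = {n \<in> F. n < N}"
      define F2 where "F2 = {n \<in> F. N \<le> n}"
      have F12: "finite F1" "finite F2" "F = F1 \<union> F2" "F1 \<inter> F2 = {}"
        using F by (auto simp: F1_def F2_def)
      show ?thesis
      proof (cases "F1 = {}")
        case True
        then have "N \<le> n" if "n \<in> F" for n using that by (auto simp: F1_def)
        with f y_B have "\<And>n. n \<in> F \<Longrightarrow> f n \<in> fin_image (B (k n)) (block_vec x (k n))"
          by metis
        then show ?thesis unfolding sF by (rule sums[OF F])
      next
        case False
        \<comment> \<open>The early summands are recombined into one row \<open>s1\<close> of
          \<open>D\<close>. It vanishes from \<open>K\<close> on, so its truncation is a row of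
          \<open>M\<close>, and the whole early sum is a single entry of the image of
          \<open>M\<close>.\<close>
        obtain s1 where s1: "s1 \<in> DH_rows B" "row_value s1 y = sum f F1"
          "\<And>n l. n \<notin> F1 \<Longrightarrow> l < dim_col (B n) \<Longrightarrow> s1 (block_start B n + l) = 0"
          using DH_row_value_compose[OF F12(1) False, of f y] f by (auto simp: F1_def)
        have "s1 j = 0" if "K \<le> j" for j
        proof -
          obtain n l where nl: "l < dim_col (B n)" "j = block_start B n + l" using block_cover by blast
          have "N \<le> n" using that nl block_start_mono[of "Suc n" N] unfolding K_def
            by (cases "N \<le> n") (auto simp: block_start_Suc)
          then show ?thesis using nl s1(3)[of n l] by (auto simp: F1_def)
        qed
        then have "sum f F1 \<in> fin_image M y"
          unfolding M_image s1(2)[symmetric] using s1(1) by auto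
        \<comment> \<open>The early sum becomes one summand at index 0, realised in block
          \<open>k 0\<close>. The slot is free because the members of \<open>F2\<close> are at least
          \<open>N\<close>, which is positive.\<close>
        define g where "g n = (if n = 0 then sum f F1 else f n)" for n
        have "0 \<notin> F2" by (simp add: F2_def N_def)
        then have g: "sum g (insert 0 F2) = sum f F1 + sum f F2"
          using F12(2) by (subst sum.insert) (auto simp: g_def intro!: sum.cong)
        have "sum g (insert 0 F2) \<in> mat_image UNIV UNIV D x"
        proof (rule sums)
          fix n assume "n \<in> insert 0 F2"
          then show "g n \<in> fin_image (B (k n)) (block_vec x (k n))"
            using \<open>sum f F1 \<in> fin_image M y\<close> f[of n] y_B[of n] by (auto simp: g_def y_M F2_def)
        qed (use F12 in auto)
        moreover have "sum f F = sum f F1 + sum f F2"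
          by (subst F12(3), rule sum.union_disjoint) (rule F12)+
        ultimately show ?thesis unfolding sF g by simp
      qed
    qed
    moreover have "row_value s y \<in> mat_image UNIV UNIV D x" if "s \<in> C ` {..<m}" for s
      using that M_in unfolding M_image by auto
    ultimately have "mat_image UNIV UNIV (stack m C D) y \<subseteq> mat_image UNIV UNIV D x"
      unfolding mat_image_UNIV[of "stack m C D"] range_stack by blast
    then show "\<exists>y\<in>pos_vecs UNIV. mat_image UNIV UNIV (stack m C D) y \<subseteq> mat_image UNIV UNIV D x"
      using y_pos by blast
  qed
qed

end
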